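(* Let $G$ be a finite group. Then the co-prime graph $\Gamma(G)$ is $C_4$-free if and only if $G$ is a nilpotent group of order $p^n$ or $2p^n$ for some prime $p$ and some integer $n\ge 0$.
   Context: For a finite group $G$, the co-prime graph $\Gamma(G)$ is the simple undirected graph with vertex set $G$ (including the identity) in which two distinct vertices $x,y$ are adjacent if and only if $\gcd(o(x),o(y))=1$, where $o(g)$ denotes the order of $g$. A graph is called $H$-free if it contains no induced subgraph isomorphic to $H$. $C_4$ is the cycle on 4 vertices. *)

theory Defs
  imports "HOL-Algebra.Multiplicative_Group" "HOL-Computational_Algebra.Primes"
    "Graph_Theory.Digraph_Isomorphism"
begin

text \<open>
  A simple undirected graph is a \<^locale>\<open>pair_graph\<close>: a finite loop-free symmetric digraph
  without parallel arcs, an edge being represented by the two opposite arcs.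
\<close>

definition coprime_graph :: "('a, 'b) monoid_scheme \<Rightarrow> 'a pair_pre_digraph" where
  "coprime_graph G =
    \<lparr> pverts = carrier G,
      parcs = {(x, y). x \<in> carrier G \<and> y \<in> carrier G \<and> x \<noteq> y \<and>
                       gcd (group.ord G x) (group.ord G y) = 1} \<rparr>"

lemma pair_graph_coprime_graph:
  assumes "finite (carrier G)"
  shows "pair_graph (coprime_graph G)"
proof
  show "finite (parcs (coprime_graph G))"
    by (rule finite_subset[of _ "carrier G \<times> carrier G"])
      (use assms in \<open>auto simp: coprime_graph_def\<close>)
  show "symmetric (with_proj (coprime_graph G))"
    by (auto simp: symmetric_def coprime_graph_def gcd.commute intro!: symI)
qed (use assms in \<open>auto simp: coprime_graph_def\<close>)

text \<open>Meaningful as the cycle on \<open>n\<close> vertices only for \<open>n \<ge> 3\<close>.\<close>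

definition cycle_graph :: "nat \<Rightarrow> nat pair_pre_digraph" where
  "cycle_graph n =
    \<lparr> pverts = {0..<n},
      parcs = {(i, j). i < n \<and> j < n \<and> (j = (i + 1) mod n \<or> i = (j + 1) mod n)} \<rparr>"

lemma pair_graph_cycle_graph:
  assumes "n \<ge> 3"
  shows "pair_graph (cycle_graph n)"
proof
  show "finite (parcs (cycle_graph n))"
    by (rule finite_subset[of _ "{0..<n} \<times> {0..<n}"]) (auto simp: cycle_graph_def)
  show "symmetric (with_proj (cycle_graph n))"
    by (auto simp: symmetric_def cycle_graph_def intro!: symI)
  show "fst e \<noteq> snd e" if "e \<in> parcs (cycle_graph n)" for e
    using that assms by (auto simp: cycle_graph_def mod_Suc split: if_splits)
qed (auto simp: cycle_graph_def)

definition induced_free :: "('c, 'd) pre_digraph \<Rightarrow> ('a, 'b) pre_digraph \<Rightarrow> bool" where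
  "induced_free H \<Gamma> \<longleftrightarrow> \<not> (\<exists>S. induced_subgraph S \<Gamma> \<and> digraph_iso S H)"

definition center :: "('a, 'b) monoid_scheme \<Rightarrow> 'a set" where
  "center G = {z \<in> carrier G. \<forall>g \<in> carrier G. z \<otimes>\<^bsub>G\<^esub> g = g \<otimes>\<^bsub>G\<^esub> z}"

text \<open>
  A group is nilpotent if it has a central series
  \<open>1 = H 0 \<le> H 1 \<le> \<dots> \<le> H k = G\<close> of normal subgroups such that every factor
  \<open>H (i + 1) / H i\<close> lies in the centre of \<open>G / H i\<close>.
\<close>

definition nilpotent_group :: "('a, 'b) monoid_scheme \<Rightarrow> bool" where
  "nilpotent_group G \<longleftrightarrow> group G \<and>
    (\<exists>(H :: nat \<Rightarrow> 'a set) k.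
      H 0 = {\<one>\<^bsub>G\<^esub>} \<and> H k = carrier G \<and>
      (\<forall>i\<le>k. H i \<lhd> G) \<and>
      (\<forall>i<k. H i \<subseteq> H (Suc i) \<and>
             (\<lambda>x. H i #>\<^bsub>G\<^esub> x) ` H (Suc i) \<subseteq> center (G Mod H i)))"

end

theory Submission
  imports Defs "HOL-Algebra.Sylow" "HOL-Algebra.Group_Action"
begin

text \<open>
  In an induced four-cycle of the co-prime graph no vertex is the identity, which is adjacent to
  everything, and opposite vertices have orders with a common factor while neighbours have coprime
  orders. So a four-cycle amounts to two pairs of distinct elements, the orders within a pair not
  coprime and the orders across the pairs coprime (\<open>coprime_graph_C4_free_iff\<close>).

  Such pairs arise as soon as two different primes \<open>p\<close> and \<open>q\<close> both have at least two non-trivial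
  elements of order a power of that prime. By Sylow this happens when prime powers
  \<open>p ^ i > 2\<close> and \<open>q ^ j > 2\<close> divide the group order. The only prime power that a second prime
  can then contribute is \<open>2\<close>, so a \<open>C\<^sub>4\<close>-free group has order \<open>p ^ n\<close> or \<open>2 * p ^ n\<close>. In the
  second case with \<open>p\<close> odd and \<open>n > 0\<close>, two involutions would again give a four-cycle, so there is just
  one involution \<open>z\<close>. Conjugation fixes it, hence it is central, and \<open>{\<one>, z}\<close> is a normal subgroup
  of index \<open>p ^ n\<close>. Since non-trivial groups of prime-power order have a non-trivial centre, every
  normal subgroup of prime-power index is joined to the whole group by a central series
  (\<open>central_series_from_prime_power_index\<close>). Applied to \<open>{\<one>}\<close> or to \<open>{\<one>, z}\<close> this proves that the
  group is nilpotent.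

  For the converse, in a group of order \<open>p ^ n\<close> all non-trivial orders are divisible by \<open>p\<close>, so
  the identity is an end of every edge. If the order is \<open>2 * p ^ n\<close> with \<open>p\<close> odd, one pair of
  opposite vertices of a four-cycle has orders prime to \<open>p\<close> and thus consists of two
  involutions \<open>a\<close> and \<open>b\<close>. Nilpotency excludes this: \<open>a\<close> inverts \<open>a b\<close>, so commuting with \<open>a\<close>
  modulo a term of a central series puts the square of \<open>a b\<close> one term further down, and repeated
  squaring reaches \<open>\<one>\<close>. The order of \<open>a b\<close> is then a power of two, hence at most \<open>2\<close>, which makes
  \<open>{\<one>, a, b, a b}\<close> a subgroup of order four in a group whose order is not a multiple of four
  (\<open>nilpotent_unique_involution\<close>).
\<close>

section \<open>Induced subgraphs as embeddings\<close>

text \<open>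
  An isomorphism carries a separate map on arcs, and new head and tail functions. When both digraphs
  represent arcs as pairs of vertices, the vertex map determines all of these.
\<close>

lemma digraph_iso_with_proj_iff:
  "digraph_iso (with_proj A) (with_proj B) \<longleftrightarrow>
    pair_wf_digraph A \<and>
    (\<exists>v. inj_on v (pverts A) \<and> pverts B = v ` pverts A \<and> parcs B = map_prod v v ` parcs A)"
    (is "_ \<longleftrightarrow> _ \<and> ?R")
proof (intro iffI conjI)
  assume "digraph_iso (with_proj A) (with_proj B)"
  then obtain f where f: "pre_digraph.digraph_isomorphism (with_proj A) f"
    and B: "with_proj B = app_iso f (with_proj A)"
    by (auto simp: digraph_iso_def)
  have verts: "pverts B = iso_verts f ` pverts A" and arcs: "parcs B = iso_arcs f ` parcs A"
    and tl: "iso_tail f = fst" and hd: "iso_head f = snd"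
    using arg_cong[OF B, of verts] arg_cong[OF B, of arcs]
      arg_cong[OF B, of tail] arg_cong[OF B, of head] by simp_all
  show "pair_wf_digraph A"
    using f by (simp add: pre_digraph.digraph_isomorphism_def wf_digraph_wp_iff)
  have "iso_arcs f e = map_prod (iso_verts f) (iso_verts f) e" if "e \<in> parcs A" for e
    using f that by (cases e) (force simp: pre_digraph.digraph_isomorphism_def tl hd prod_eq_iff)
  then have "parcs B = map_prod (iso_verts f) (iso_verts f) ` parcs A"
    using arcs by simp
  moreover have "inj_on (iso_verts f) (pverts A)"
    using f by (simp add: pre_digraph.digraph_isomorphism_def)
  ultimately show ?R
    using verts by blast
next
  assume R: "pair_wf_digraph A \<and> ?R"
  then obtain v where v: "inj_on v (pverts A)" "pverts B = v ` pverts A"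
    "parcs B = map_prod v v ` parcs A"
    by blast
  let ?f = "\<lparr>iso_verts = v, iso_arcs = map_prod v v, iso_head = snd, iso_tail = fst\<rparr>"
  have "parcs A \<subseteq> pverts A \<times> pverts A"
    using R by (auto simp: pair_wf_digraph_def)
  then have "inj_on (map_prod v v) (parcs A)"
    using v(1) by (auto intro: inj_on_subset map_prod_inj_on)
  then have "pre_digraph.digraph_isomorphism (with_proj A) ?f"
    using R v by (auto simp: pre_digraph.digraph_isomorphism_def wf_digraph_wp_iff)
  moreover have "with_proj B = app_iso ?f (with_proj A)"
    using v by (simp add: app_iso_def with_proj_def)
  ultimately show "digraph_iso (with_proj A) (with_proj B)"
    by (auto simp: digraph_iso_def)
qed

text \<open>
  An isomorphism goes from the subgraph of \<open>\<Gamma>\<close> to \<open>H\<close>. Its inverse is an embedding of \<open>H\<close>, and the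
  subgraph can be recovered as the one induced on the image, so it need not be mentioned.
\<close>

lemma induced_free_iff_no_embedding:
  assumes wfH: "pair_wf_digraph H" and wf\<Gamma>: "pair_wf_digraph \<Gamma>"
  shows "induced_free (with_proj H) (with_proj \<Gamma>) \<longleftrightarrow>
    \<not> (\<exists>u. inj_on u (pverts H) \<and> u ` pverts H \<subseteq> pverts \<Gamma> \<and>
           (\<forall>i \<in> pverts H. \<forall>j \<in> pverts H. (u i, u j) \<in> parcs \<Gamma> \<longleftrightarrow> (i, j) \<in> parcs H))"
    (is "_ \<longleftrightarrow> \<not> (\<exists>u. ?E u)")
proof -
  have H: "parcs H \<subseteq> pverts H \<times> pverts H"
    using wfH by (auto simp: pair_wf_digraph_def)
  have "(\<exists>S. induced_subgraph S (with_proj \<Gamma>) \<and> digraph_iso S (with_proj H)) \<longleftrightarrow> (\<exists>u. ?E u)"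
  proof
    assume "\<exists>S. induced_subgraph S (with_proj \<Gamma>) \<and> digraph_iso S (with_proj H)"
    then obtain S where ind: "induced_subgraph S (with_proj \<Gamma>)"
      and iso: "digraph_iso S (with_proj H)"
      by blast
    let ?A = "\<lparr>pverts = verts S, parcs = arcs S\<rparr>"
    have "tail S = fst" "head S = snd" and sub: "verts S \<subseteq> pverts \<Gamma>"
      and arcs: "arcs S = {e \<in> parcs \<Gamma>. fst e \<in> verts S \<and> snd e \<in> verts S}"
      using ind by (auto simp: induced_subgraph_def subgraph_def compatible_def)
    then have "S = with_proj ?A"
      by (simp add: with_proj_def)
    with iso have "digraph_iso (with_proj ?A) (with_proj H)"
      by simp
    then obtain v where v: "inj_on v (verts S)" "pverts H = v ` verts S"
      "parcs H = map_prod v v ` arcs S"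
      unfolding digraph_iso_with_proj_iff by auto
    let ?u = "inv_into (verts S) v"
    have u: "?u i \<in> verts S" "v (?u i) = i" if "i \<in> pverts H" for i
      using that v(2) by (auto intro: inv_into_into f_inv_into_f)
    have "(?u i, ?u j) \<in> parcs \<Gamma> \<longleftrightarrow> (i, j) \<in> parcs H"
      if ij: "i \<in> pverts H" "j \<in> pverts H" for i j
    proof
      assume "(?u i, ?u j) \<in> parcs \<Gamma>"
      then have "(?u i, ?u j) \<in> arcs S"
        using arcs u ij by simp
      then have "map_prod v v (?u i, ?u j) \<in> parcs H"
        unfolding v(3) by (rule imageI)
      then show "(i, j) \<in> parcs H"
        using u ij by simp
    next
      assume "(i, j) \<in> parcs H"
      then obtain x y where "(x, y) \<in> arcs S" "i = v x" "j = v y"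
        using v(3) by auto
      then show "(?u i, ?u j) \<in> parcs \<Gamma>"
        using arcs v(1) by simp
    qed
    moreover have "inj_on ?u (pverts H)"
      using v(2) by (simp add: inj_on_inv_into)
    ultimately have "?E ?u"
      using u sub by auto
    then show "\<exists>u. ?E u" by (rule exI[of ?E])
  next
    assume "\<exists>u. ?E u"
    then obtain u where u: "?E u" ..
    let ?A = "\<lparr>pverts = u ` pverts H, parcs = parcs \<Gamma> \<inter> (u ` pverts H \<times> u ` pverts H)\<rparr>"
    let ?v = "the_inv_into (pverts H) u"
    have wfA: "pair_wf_digraph ?A"
      by unfold_locales auto
    then have ind: "induced_subgraph (with_proj ?A) (with_proj \<Gamma>)"
      using u wf\<Gamma> by (auto simp: induced_subgraph_def subgraph_def wf_digraph_wp_iff)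
    have v: "?v (u i) = i" if "i \<in> pverts H" for i
      using u that by (simp add: the_inv_into_f_f)
    have "parcs H = map_prod ?v ?v ` parcs ?A"
    proof (intro equalityI subsetI)
      fix e assume e: "e \<in> parcs H"
      then obtain i j where ij: "e = (i, j)" "i \<in> pverts H" "j \<in> pverts H"
        using H by auto
      then show "e \<in> map_prod ?v ?v ` parcs ?A"
        using e u v by (intro image_eqI[of _ _ "(u i, u j)"]) auto
    qed (use u v in auto)
    moreover have "inj_on ?v (pverts ?A)"
      using u by (simp add: inj_on_the_inv_into)
    moreover have "pverts H = ?v ` pverts ?A"
      using v by (force simp: image_image)
    ultimately have "digraph_iso (with_proj ?A) (with_proj H)"
      unfolding digraph_iso_with_proj_iff using wfA by blast
    with ind show "\<exists>S. induced_subgraph S (with_proj \<Gamma>) \<and> digraph_iso S (with_proj H)"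
      by blast
  qed
  then show ?thesis
    by (simp add: induced_free_def)
qed

lemma parcs_cycle_graph_4:
  "parcs (cycle_graph 4) = {(0,1), (1,2), (2,3), (3,0), (1,0), (2,1), (3,2), (0,3)}"
    (is "_ = ?E")
proof -
  have "(i, j) \<in> parcs (cycle_graph 4) \<longleftrightarrow> (i, j) \<in> ?E" for i j
  proof (cases "i < 4 \<and> j < 4")
    case True
    then have "i = 0 \<or> i = 1 \<or> i = 2 \<or> i = 3" "j = 0 \<or> j = 1 \<or> j = 2 \<or> j = 3"
      by linarith+
    then show ?thesis
      by (elim disjE) (simp_all add: cycle_graph_def)
  qed (auto simp: cycle_graph_def)
  then show ?thesis
    by (simp only: set_eq_iff split_paired_All) simp
qed

text \<open>
  The two diagonals are the only pairs whose distinctness has to be demanded: neighbours differ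
  because there are no loops.
\<close>

lemma induced_C4_free_iff:
  assumes "pair_graph \<Gamma>"
  shows "induced_free (with_proj (cycle_graph 4)) (with_proj \<Gamma>) \<longleftrightarrow>
    \<not> (\<exists>a b c d. a \<noteq> c \<and> b \<noteq> d \<and>
         (a, b) \<in> parcs \<Gamma> \<and> (b, c) \<in> parcs \<Gamma> \<and> (c, d) \<in> parcs \<Gamma> \<and> (d, a) \<in> parcs \<Gamma> \<and>
         (a, c) \<notin> parcs \<Gamma> \<and> (b, d) \<notin> parcs \<Gamma>)"
    (is "_ \<longleftrightarrow> \<not> ?C")
proof -
  interpret pair_graph \<Gamma> by fact
  interpret C: pair_graph "cycle_graph 4"
    by (rule pair_graph_cycle_graph) simp
  have sym: "(y, x) \<in> parcs \<Gamma>" if "(x, y) \<in> parcs \<Gamma>" for x y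
    using that by (rule arcs_symmetric)
  have irrefl: "(x, x) \<notin> parcs \<Gamma>" for x
    using no_loops by fastforce
  have V: "pverts (cycle_graph 4) = {0, 1, 2, 3}"
    by (auto simp: cycle_graph_def)
  note E = parcs_cycle_graph_4
  have "(\<exists>u. inj_on u (pverts (cycle_graph 4)) \<and> u ` pverts (cycle_graph 4) \<subseteq> pverts \<Gamma> \<and>
           (\<forall>i \<in> pverts (cycle_graph 4). \<forall>j \<in> pverts (cycle_graph 4).
              (u i, u j) \<in> parcs \<Gamma> \<longleftrightarrow> (i, j) \<in> parcs (cycle_graph 4))) \<longleftrightarrow> ?C"
    (is "(\<exists>u. ?P u) \<longleftrightarrow> _")
  proof
    assume "\<exists>u. ?P u"
    then obtain u where "?P u" ..
    then have "u 0 \<noteq> u 2 \<and> u 1 \<noteq> u 3 \<and>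
      (u 0, u 1) \<in> parcs \<Gamma> \<and> (u 1, u 2) \<in> parcs \<Gamma> \<and> (u 2, u 3) \<in> parcs \<Gamma> \<and> (u 3, u 0) \<in> parcs \<Gamma> \<and>
      (u 0, u 2) \<notin> parcs \<Gamma> \<and> (u 1, u 3) \<notin> parcs \<Gamma>"
      unfolding V E by simp
    then show ?C
      by blast
  next
    assume ?C
    then obtain a b c d where *: "a \<noteq> c" "b \<noteq> d"
      "(a, b) \<in> parcs \<Gamma>" "(b, c) \<in> parcs \<Gamma>" "(c, d) \<in> parcs \<Gamma>" "(d, a) \<in> parcs \<Gamma>"
      "(a, c) \<notin> parcs \<Gamma>" "(b, d) \<notin> parcs \<Gamma>"
      by blast
    moreover have "(c, a) \<notin> parcs \<Gamma>" "(d, b) \<notin> parcs \<Gamma>"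
      "(b, a) \<in> parcs \<Gamma>" "(c, b) \<in> parcs \<Gamma>" "(d, c) \<in> parcs \<Gamma>" "(a, d) \<in> parcs \<Gamma>"
      using * sym by blast+
    moreover have "a \<noteq> b" "b \<noteq> c" "c \<noteq> d" "d \<noteq> a"
      using * irrefl by auto
    moreover have "a \<in> pverts \<Gamma>" "b \<in> pverts \<Gamma>" "c \<in> pverts \<Gamma>" "d \<in> pverts \<Gamma>"
      using * in_arcsD1 by blast+
    ultimately have "?P (\<lambda>i. if i = 0 then a else if i = 1 then b else if i = 2 then c else d)"
      unfolding V E using irrefl by simp
    then show "\<exists>u. ?P u" by (rule exI[of ?P])
  qed
  then show ?thesis
    by (simp add: induced_free_iff_no_embedding C.pair_wf_digraph_axioms pair_wf_digraph_axioms)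
qed

text \<open>
  Opposite vertices are distinct and non-adjacent, so their orders have a common factor. This excludes
  the identity, so elements of coprime orders are automatically distinct here.
\<close>

lemma (in group) coprime_graph_C4_free_iff:
  assumes "finite (carrier G)"
  shows "induced_free (with_proj (cycle_graph 4)) (with_proj (coprime_graph G)) \<longleftrightarrow>
    \<not> (\<exists>a \<in> carrier G. \<exists>b \<in> carrier G. \<exists>c \<in> carrier G. \<exists>d \<in> carrier G.
         a \<noteq> c \<and> b \<noteq> d \<and> \<not> coprime (ord a) (ord c) \<and> \<not> coprime (ord b) (ord d) \<and>
         coprime (ord a) (ord b) \<and> coprime (ord b) (ord c) \<and>
         coprime (ord c) (ord d) \<and> coprime (ord d) (ord a))"
    (is "_ \<longleftrightarrow> \<not> ?C")
proof -
  have arc: "(x, y) \<in> parcs (coprime_graph G) \<longleftrightarrow>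
      x \<in> carrier G \<and> y \<in> carrier G \<and> x \<noteq> y \<and> coprime (ord x) (ord y)" for x y
    by (auto simp: coprime_graph_def coprime_iff_gcd_eq_1)
  have ne: "x \<noteq> y" if "coprime (ord x) (ord y)" "\<not> coprime (ord x) (ord z)" for x y z
    using that by auto
  have "(\<exists>a b c d. a \<noteq> c \<and> b \<noteq> d \<and>
         (a, b) \<in> parcs (coprime_graph G) \<and> (b, c) \<in> parcs (coprime_graph G) \<and>
         (c, d) \<in> parcs (coprime_graph G) \<and> (d, a) \<in> parcs (coprime_graph G) \<and>
         (a, c) \<notin> parcs (coprime_graph G) \<and> (b, d) \<notin> parcs (coprime_graph G)) \<longleftrightarrow> ?C"
    (is "?L \<longleftrightarrow> _")
  proof
    assume ?L
    then show ?C
      unfolding arc by blast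
  next
    assume ?C
    then obtain a b c d where *: "a \<in> carrier G" "b \<in> carrier G" "c \<in> carrier G" "d \<in> carrier G"
      "a \<noteq> c" "b \<noteq> d" "\<not> coprime (ord a) (ord c)" "\<not> coprime (ord b) (ord d)"
      "coprime (ord a) (ord b)" "coprime (ord b) (ord c)"
      "coprime (ord c) (ord d)" "coprime (ord d) (ord a)"
      by blast
    then have "a \<noteq> b" "b \<noteq> c" "c \<noteq> d" "d \<noteq> a"
      using ne by (metis coprime_commute)+
    with * show ?L
      unfolding arc by blast
  qed
  then show ?thesis
    by (simp add: induced_C4_free_iff pair_graph_coprime_graph assms)
qed

section \<open>Central series above a normal subgroup of prime-power index\<close>

lemma prime_dvd_if_dvd_prime_power:
  fixes m p :: nat
  assumes "m \<noteq> 1" "m dvd p ^ k" "Factorial_Ring.prime p"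
  shows "p dvd m"
proof -
  obtain i where "m = p ^ i"
    using assms by (auto simp: divides_primepow_nat)
  with assms(1) show ?thesis
    by (cases i) auto
qed

text \<open>
  The class equation: a conjugacy class has size dividing \<open>p ^ k\<close>, and size one only for
  central elements. If \<open>\<one>\<close> were the only central element, the group order would be \<open>1\<close>
  modulo \<open>p\<close>.
\<close>

lemma (in group) prime_power_order_nontrivial_center:
  assumes p: "Factorial_Ring.prime p" and ord: "order G = p ^ k" and nontriv: "carrier G \<noteq> {\<one>}"
  shows "center G \<noteq> {\<one>}"
proof
  assume trivial: "center G = {\<one>}"
  have fin: "finite (carrier G)"
    using ord p order_gt_0_iff_finite by (simp add: prime_gt_0_nat)
  let ?\<phi> = "\<lambda>g. \<lambda>h \<in> carrier G. g \<otimes> h \<otimes> inv g"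
  interpret conj: group_action G "carrier G" ?\<phi>
    by (rule action_by_conjugation)
  let ?O = "orbits G (carrier G) ?\<phi>"
  have orbit_one: "orbit G ?\<phi> \<one> = {\<one>}"
    by (auto simp: orbit_def intro!: exI[of _ \<one>])
  then have one_in: "{\<one>} \<in> ?O"
    unfolding orbits_def by force
  have dvd: "p dvd card B" if B: "B \<in> ?O - {{\<one>}}" for B
  proof -
    obtain x where x: "x \<in> carrier G" "B = orbit G ?\<phi> x"
      using B by (auto simp: orbits_def)
    have "x \<noteq> \<one>"
      using B x orbit_one by auto
    then have "x \<notin> center G"
      using trivial by simp
    then obtain g where g: "g \<in> carrier G" "x \<otimes> g \<noteq> g \<otimes> x"
      using x by (auto simp: center_def)
    have x_in: "x \<in> B"
      using conj.orbit_refl x by blast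
    have gx_in: "g \<otimes> x \<otimes> inv g \<in> B"
      using x g by (auto simp: orbit_def intro!: exI[of _ g])
    have "g \<otimes> x \<otimes> inv g \<noteq> x"
      using x g by (auto simp: inv_solve_right')
    then have "card B \<noteq> 1"
      using x_in gx_in by (metis card_1_singletonE singletonD)
    moreover have "card B dvd p ^ k"
      using conj.orbit_stabilizer_theorem[OF x(1)] unfolding x(2) ord[symmetric]
      by (rule dvdI[OF sym])
    ultimately show ?thesis
      using prime_dvd_if_dvd_prime_power p by blast
  qed
  have finO: "finite ?O"
    using fin by (simp add: orbits_def)
  have "card (carrier G) = (\<Sum>B \<in> ?O. card B)"
    using conj.disjoint_sum[OF fin, of "\<lambda>_. 1 :: nat"] by simp
  also have "\<dots> = 1 + (\<Sum>B \<in> ?O - {{\<one>}}. card B)"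
    using finO one_in by (simp add: sum.remove)
  finally have "order G = 1 + (\<Sum>B \<in> ?O - {{\<one>}}. card B)"
    by (simp add: order_def)
  moreover have "p dvd (\<Sum>B \<in> ?O - {{\<one>}}. card B)"
    using dvd by (rule dvd_sum)
  moreover have "p dvd order G"
  proof -
    have "order G \<noteq> 1"
      using nontriv fin by (metis card_1_singletonE one_closed order_def singletonD)
    then show ?thesis
      using ord by (cases k) auto
  qed
  ultimately have "p dvd 1"
    by (simp only: dvd_add_left_iff)
  then show False
    using p by (simp add: prime_nat_iff)
qed

lemma (in normal) rcos_mem_center_iff:
  assumes "x \<in> carrier G"
  shows "H #> x \<in> center (G Mod H) \<longleftrightarrow> (\<forall>g \<in> carrier G. H #> (x \<otimes> g) = H #> (g \<otimes> x))"
  using assms by (auto simp: center_def carrier_FactGroup rcos_sum)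

text \<open>
  The largest possible next term above \<open>N\<close> in a central series: the full preimage of the centre
  of \<open>G Mod N\<close>.
\<close>

definition central_preimage :: "('a, 'b) monoid_scheme \<Rightarrow> 'a set \<Rightarrow> 'a set" where
  "central_preimage G N = {x \<in> carrier G. N #>\<^bsub>G\<^esub> x \<in> center (G Mod N)}"

lemma (in normal) mem_central_preimage_iff:
  "x \<in> central_preimage G H \<longleftrightarrow>
    x \<in> carrier G \<and> (\<forall>g \<in> carrier G. H #> (x \<otimes> g) = H #> (g \<otimes> x))"
  by (auto simp: central_preimage_def rcos_mem_center_iff)

lemma (in normal) central_preimageI:
  assumes "\<And>g. g \<in> carrier G \<Longrightarrow> H #> (x \<otimes> g) = H #> (g \<otimes> x)" and "x \<in> carrier G"
  shows "x \<in> central_preimage G H"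
  using assms mem_central_preimage_iff by blast

lemma (in normal) central_preimage_normal: "central_preimage G H \<lhd> G"
proof (rule normal_invI)
  have comm: "H #> (x \<otimes> g) = H #> (g \<otimes> x)" if "x \<in> central_preimage G H" "g \<in> carrier G" for x g
    using that mem_central_preimage_iff by blast
  have carr: "x \<in> carrier G" if "x \<in> central_preimage G H" for x
    using that mem_central_preimage_iff by blast
  show "subgroup (central_preimage G H) G"
  proof
    show "central_preimage G H \<subseteq> carrier G"
      using carr by blast
    show "\<one> \<in> central_preimage G H"
      by (simp add: mem_central_preimage_iff)
  next
    fix x y assume xy: "x \<in> central_preimage G H" "y \<in> central_preimage G H"
    have "H #> (x \<otimes> y \<otimes> g) = H #> (g \<otimes> (x \<otimes> y))" if g: "g \<in> carrier G" for g
    proof -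
      have "H #> (x \<otimes> y \<otimes> g) = (H #> x) <#> (H #> (y \<otimes> g))"
        using xy g carr by (simp add: rcos_sum m_assoc)
      also have "\<dots> = H #> (x \<otimes> (g \<otimes> y))"
        using xy g carr comm by (simp add: rcos_sum)
      also have "\<dots> = (H #> (x \<otimes> g)) <#> (H #> y)"
        using xy g carr by (simp add: rcos_sum m_assoc)
      also have "\<dots> = H #> (g \<otimes> (x \<otimes> y))"
        using xy g carr comm by (simp add: rcos_sum m_assoc)
      finally show ?thesis .
    qed
    then show "x \<otimes> y \<in> central_preimage G H"
      by (rule central_preimageI) (auto intro: carr xy)
  next
    fix x assume x: "x \<in> central_preimage G H"
    have "H #> (inv x \<otimes> g) = H #> (g \<otimes> inv x)" if g: "g \<in> carrier G" for g
    proof -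
      have "H #> (inv x \<otimes> g) = (H #> (inv x \<otimes> (g \<otimes> x))) <#> (H #> inv x)"
        using x g carr by (simp add: rcos_sum m_assoc)
      also have "H #> (inv x \<otimes> (g \<otimes> x)) = (H #> inv x) <#> (H #> (x \<otimes> g))"
        using x g carr comm by (simp add: rcos_sum)
      also have "\<dots> = H #> g"
        using x g carr by (simp add: rcos_sum m_assoc[symmetric])
      finally show ?thesis
        using x g carr by (simp add: rcos_sum)
    qed
    then show "inv x \<in> central_preimage G H"
      by (rule central_preimageI) (auto intro: carr x)
  qed
  fix g x assume g: "g \<in> carrier G" and x: "x \<in> central_preimage G H"
  have "H #> (g \<otimes> x \<otimes> inv g) = (H #> (x \<otimes> g)) <#> (H #> inv g)"
    using x g carr comm by (simp add: rcos_sum)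
  also have "\<dots> = H #> x"
    using x g carr by (simp add: rcos_sum m_assoc)
  finally show "g \<otimes> x \<otimes> inv g \<in> central_preimage G H"
    using x g by (simp add: central_preimage_def)
qed

text \<open>
  The coset of an element of \<open>H\<close> is the identity of the quotient, which is central.
\<close>

lemma (in normal) subset_central_preimage: "H \<subseteq> central_preimage G H"
proof
  fix x assume x: "x \<in> H"
  have "H #> (x \<otimes> g) = H #> (g \<otimes> x)" if g: "g \<in> carrier G" for g
  proof -
    have x1: "H #> x = H #> \<one>"
      using rcos_const[OF is_group x] subset by (simp add: coset_mult_one)
    have "H #> (x \<otimes> g) = (H #> \<one>) <#> (H #> g)"
      using x g x1 by (metis mem_carrier rcos_sum)
    also have "\<dots> = (H #> g) <#> (H #> \<one>)"
      using g by (simp only: rcos_sum one_closed l_one r_one group.is_monoid monoid.one_closed)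
    also have "\<dots> = H #> (g \<otimes> x)"
      using x g x1 by (metis mem_carrier rcos_sum)
    finally show ?thesis .
  qed
  then show "x \<in> central_preimage G H"
    by (rule central_preimageI) (auto intro: mem_carrier x)
qed

text \<open>
  The quotient by \<open>H\<close> is a non-trivial group of prime-power order. A coset other than \<open>H\<close> in its centre
  has representatives in the preimage outside \<open>H\<close>.
\<close>

lemma (in normal) psubset_central_preimage:
  assumes fin: "finite (carrier G)" and p: "Factorial_Ring.prime p"
    and ord: "order G = card H * p ^ k" and proper: "H \<noteq> carrier G"
  shows "H \<subset> central_preimage G H"
proof -
  interpret Q: group "G Mod H"
    by (rule factorgroup_is_group)
  have "card H > 0"
    using finite_subset[OF subset fin] subgroup.one_closed[OF subgroup_axioms]
    by (metis card_gt_0_iff empty_iff)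
  then have "order (G Mod H) = p ^ k"
    using lagrange[OF subgroup_axioms] ord by (simp add: order_def FactGroup_def)
  moreover have "carrier (G Mod H) \<noteq> {\<one>\<^bsub>G Mod H\<^esub>}"
  proof
    assume trivial: "carrier (G Mod H) = {\<one>\<^bsub>G Mod H\<^esub>}"
    have "x \<in> H" if x: "x \<in> carrier G" for x
      using trivial x rcos_self[OF x subgroup_axioms] by (auto simp: carrier_FactGroup)
    then show False
      using proper subset by blast
  qed
  ultimately have "center (G Mod H) \<noteq> {\<one>\<^bsub>G Mod H\<^esub>}"
    by (rule Q.prime_power_order_nontrivial_center[OF p])
  moreover have "\<one>\<^bsub>G Mod H\<^esub> \<in> center (G Mod H)"
    using Q.one_closed Q.l_one Q.r_one unfolding center_def by auto
  ultimately obtain C where C: "C \<in> center (G Mod H)" "C \<noteq> H"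
    by auto
  then obtain x where x: "x \<in> carrier G" "C = H #> x"
    by (auto simp: center_def carrier_FactGroup)
  then have "x \<in> central_preimage G H" "x \<notin> H"
    using C rcos_const[OF is_group] by (auto simp: central_preimage_def)
  then show ?thesis
    using subset_central_preimage by blast
qed

text \<open>
  Nilpotency with a variable bottom term in place of \<open>{\<one>}\<close>, so that a series can be
  constructed from the top down by induction on the index of its bottom term.
\<close>

definition central_series_from :: "('a, 'b) monoid_scheme \<Rightarrow> 'a set \<Rightarrow> bool" where
  "central_series_from G N \<longleftrightarrow>
    (\<exists>(H :: nat \<Rightarrow> 'a set) k.
      H 0 = N \<and> H k = carrier G \<and>
      (\<forall>i\<le>k. H i \<lhd> G) \<and>
      (\<forall>i<k. H i \<subseteq> H (Suc i) \<and>
             (\<lambda>x. H i #>\<^bsub>G\<^esub> x) ` H (Suc i) \<subseteq> center (G Mod H i)))"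

lemma nilpotent_group_iff: "nilpotent_group G \<longleftrightarrow> group G \<and> central_series_from G {\<one>\<^bsub>G\<^esub>}"
  by (simp add: nilpotent_group_def central_series_from_def)

lemma (in group) central_series_from_carrier: "central_series_from G (carrier G)"
proof -
  have "carrier G \<lhd> G"
    by (rule normal_invI) (auto simp: subgroup_self)
  then show ?thesis
    unfolding central_series_from_def
    by (intro exI[of _ "\<lambda>_. carrier G"] exI[of _ 0]) simp
qed

lemma central_series_from_step:
  assumes N: "N \<lhd> G" and sub: "N \<subseteq> M" and central: "M \<subseteq> central_preimage G N"
    and M: "central_series_from G M"
  shows "central_series_from G N"
proof -
  obtain H k where H: "H 0 = M" "H k = carrier G" "\<forall>i\<le>k. H i \<lhd> G"
    "\<forall>i<k. H i \<subseteq> H (Suc i) \<and> (\<lambda>x. H i #>\<^bsub>G\<^esub> x) ` H (Suc i) \<subseteq> center (G Mod H i)"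
    using M unfolding central_series_from_def by blast
  let ?K = "case_nat N H"
  have "?K 0 = N" "?K (Suc k) = carrier G"
    using H by simp_all
  moreover have "\<forall>i\<le>Suc k. ?K i \<lhd> G"
    using H N by (auto split: nat.split)
  moreover have "\<forall>i<Suc k. ?K i \<subseteq> ?K (Suc i) \<and>
      (\<lambda>x. ?K i #>\<^bsub>G\<^esub> x) ` ?K (Suc i) \<subseteq> center (G Mod ?K i)"
    using H sub central by (auto simp: central_preimage_def split: nat.split)
  ultimately show ?thesis
    unfolding central_series_from_def by blast
qed

text \<open>
  If \<open>N\<close> is proper, the preimage of the centre of \<open>G Mod N\<close> is a strictly larger normal subgroup,
  whose index divides that of \<open>N\<close> and is therefore a smaller power of \<open>p\<close>. A series from there is
  extended by \<open>N\<close>.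
\<close>

lemma (in group) central_series_from_prime_power_index:
  assumes "finite (carrier G)" and p: "Factorial_Ring.prime p"
    and "N \<lhd> G" and "order G = card N * p ^ k"
  shows "central_series_from G N"
  using assms(3,4)
proof (induction k arbitrary: N rule: less_induct)
  case (less k)
  interpret N: normal N G by fact
  show ?case
  proof (cases "N = carrier G")
    case True
    then show ?thesis
      by (simp add: central_series_from_carrier)
  next
    case False
    let ?M = "central_preimage G N"
    have M: "?M \<lhd> G" and psub: "N \<subset> ?M"
      using N.central_preimage_normal N.psubset_central_preimage[OF assms(1) p less.prems(2) False]
      by auto
    interpret M: normal ?M G by fact
    have "subgroup N (G\<lparr>carrier := ?M\<rparr>)"
      using psub N.subgroup_axioms M.subgroup_axioms by (intro subgroup_incl) auto
    then have "card (rcosets\<^bsub>G\<lparr>carrier := ?M\<rparr>\<^esub> N) * card N = card ?M"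
      using group.lagrange[OF M.subgroup_is_group[OF is_group]] by (simp add: order_def)
    then obtain s where s: "card ?M = s * card N"
      by metis
    have "card (rcosets ?M) * card ?M = order G"
      by (rule lagrange) (rule M.subgroup_axioms)
    with s less.prems obtain t where t: "order G = t * card ?M"
      by metis
    have pos: "card N > 0"
      using finite_subset[OF N.subset assms(1)] subgroup.one_closed[OF N.subgroup_axioms]
      by (metis card_gt_0_iff empty_iff)
    have less: "card N < card ?M"
      using finite_subset[OF M.subset assms(1)] psub by (rule psubset_card_mono)
    have ts: "t * s = p ^ k"
      using less.prems(2) s t pos by simp
    then obtain j where j: "j \<le> k" "t = p ^ j"
      using p by (metis divides_primepow_nat dvd_triv_left)
    have "s \<noteq> 1"
      using s less by auto
    then have "j < k"
      using ts j p by (cases "j = k") auto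
    then have "central_series_from G ?M"
      using less.IH M t j by (simp add: mult.commute)
    then show ?thesis
      using central_series_from_step less.prems(1) psub by blast
  qed
qed

lemma (in group) prime_power_order_nilpotent:
  assumes p: "Factorial_Ring.prime p" and ord: "order G = p ^ k"
  shows "nilpotent_group G"
proof -
  have "finite (carrier G)"
    using ord p order_gt_0_iff_finite by (simp add: prime_gt_0_nat)
  then show ?thesis
    using central_series_from_prime_power_index[OF _ p one_is_normal] ord
    by (simp add: nilpotent_group_iff is_group)
qed

section \<open>Involutions\<close>

lemma (in group) ord_eq_2_iff:
  assumes "x \<in> carrier G"
  shows "ord x = 2 \<longleftrightarrow> x \<noteq> \<one> \<and> x \<otimes> x = \<one>"
proof -
  have "x \<otimes> x = \<one> \<longleftrightarrow> ord x dvd 2"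
    using assms pow_eq_id[of x 2] by (simp add: numeral_2_eq_2)
  also have "\<dots> \<longleftrightarrow> ord x = 1 \<or> ord x = 2"
    by (metis prime_nat_iff two_is_prime_nat dvd_refl one_dvd)
  finally show ?thesis
    using assms ord_eq_1 by auto
qed

text \<open>
  Conjugates of an involution are involutions, so a unique one is central, and the
  subgroup \<open>{\<one>, z}\<close> that it generates can serve as the first step of a central series. What
  remains above it has index \<open>p ^ k\<close>.
\<close>

lemma (in group) nilpotent_if_unique_involution:
  assumes fin: "finite (carrier G)" and p: "Factorial_Ring.prime p" and ord: "order G = 2 * p ^ k"
    and z: "z \<in> carrier G" "ord z = 2"
    and unique: "\<And>x. x \<in> carrier G \<Longrightarrow> ord x = 2 \<Longrightarrow> x = z"
  shows "nilpotent_group G"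
proof -
  have zz: "z \<noteq> \<one>" "z \<otimes> z = \<one>"
    using z ord_eq_2_iff by auto
  then have inv_z: "inv z = z"
    using z by (simp add: inv_equality)
  have conj: "g \<otimes> z \<otimes> inv g = z" if g: "g \<in> carrier G" for g
  proof (rule unique)
    have "g \<otimes> z \<otimes> inv g \<otimes> (g \<otimes> z \<otimes> inv g) = g \<otimes> (z \<otimes> (inv g \<otimes> g) \<otimes> z) \<otimes> inv g"
      using g z(1) by (simp only: m_assoc inv_closed m_closed)
    also have "\<dots> = \<one>"
      using g z zz by simp
    finally have "g \<otimes> z \<otimes> inv g \<otimes> (g \<otimes> z \<otimes> inv g) = \<one>" .
    moreover have "g \<otimes> z \<otimes> inv g \<noteq> \<one>"
      using g z zz by (metis inv_solve_right l_cancel_one one_closed l_one m_closed r_cancel_one')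
    ultimately show "ord (g \<otimes> z \<otimes> inv g) = 2"
      using g z by (simp add: ord_eq_2_iff)
  qed (use g z in simp)
  have central: "g \<otimes> z = z \<otimes> g" if "g \<in> carrier G" for g
    using conj[OF that] that z by (metis inv_solve_right m_closed)
  have "subgroup {\<one>, z} G"
    using z zz inv_z by unfold_locales auto
  then have N: "{\<one>, z} \<lhd> G"
    by (rule normal_invI) (auto simp: conj)
  then have "central_series_from G {\<one>, z}"
    using zz ord by (intro central_series_from_prime_power_index[OF fin p, where k = k]) simp_all
  moreover have "{\<one>, z} \<subseteq> central_preimage G {\<one>}"
    using z central by (simp add: normal.mem_central_preimage_iff[OF one_is_normal])
  ultimately show ?thesis
    using central_series_from_step[OF one_is_normal, of "{\<one>, z}"]
    by (simp add: nilpotent_group_iff is_group)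
qed

text \<open>
  If \<open>a\<close> inverts \<open>y\<close>, the commutator of \<open>y\<close> and \<open>a\<close> is \<open>y\<close> squared. In a central series,
  commutators with an element of one term lie in the term below, and powers of \<open>x\<close> are inverted
  by \<open>a\<close> as well, so every squaring moves one term down.
\<close>

lemma (in group) inverted_element_of_nilpotent:
  assumes nil: "nilpotent_group G" and a: "a \<in> carrier G" and x: "x \<in> carrier G"
    and inverts: "a \<otimes> x \<otimes> inv a = inv x"
  shows "\<exists>k. x [^] (2 ^ k :: nat) = \<one>"
proof -
  obtain H k where H: "H 0 = {\<one>}" "H k = carrier G" "\<forall>i\<le>k. H i \<lhd> G"
    "\<forall>i<k. H i \<subseteq> H (Suc i) \<and> (\<lambda>x. H i #> x) ` H (Suc i) \<subseteq> center (G Mod H i)"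
    using nil by (auto simp: nilpotent_group_def)
  have square: "y \<otimes> y \<in> H i"
    if i: "i < k" and y: "y \<in> H (Suc i)" "a \<otimes> y \<otimes> inv a = inv y" for i y
  proof -
    interpret N: normal "H i" G
      using H(3) i by simp
    have "y \<in> carrier G"
      using H(3) i y(1) normal_imp_subgroup subgroup.mem_carrier Suc_leI by metis
    moreover have "H i #> y \<in> center (G Mod H i)"
      using H(4) i y(1) by blast
    ultimately have "H i #> (y \<otimes> a) = H i #> (a \<otimes> y)"
      using a by (simp add: N.rcos_mem_center_iff)
    then have "y \<otimes> a \<in> H i #> (a \<otimes> y)"
      using rcos_self[OF _ N.subgroup_axioms] a \<open>y \<in> carrier G\<close> by (metis m_closed)
    then have "y \<otimes> a \<otimes> inv (a \<otimes> y) \<in> H i"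
      using N.rcos_module_imp[OF is_group] a \<open>y \<in> carrier G\<close> by simp
    also have "y \<otimes> a \<otimes> inv (a \<otimes> y) = y \<otimes> inv (a \<otimes> y \<otimes> inv a)"
      using a \<open>y \<in> carrier G\<close> by (simp add: inv_mult_group m_assoc)
    also have "\<dots> = y \<otimes> y"
      using y(2) \<open>y \<in> carrier G\<close> by simp
    finally show ?thesis .
  qed
  have inv_pow: "a \<otimes> (x [^] n) \<otimes> inv a = inv (x [^] n)" for n :: nat
  proof (induction n)
    case 0
    then show ?case using a by simp
  next
    case (Suc n)
    have "a \<otimes> (x [^] Suc n) \<otimes> inv a = (a \<otimes> (x [^] n) \<otimes> inv a) \<otimes> (a \<otimes> x \<otimes> inv a)"
      using a x by (simp add: m_assoc inv_solve_left inv_solve_left')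
    also have "\<dots> = inv (x \<otimes> x [^] n)"
      using Suc inverts x by (simp add: inv_mult_group)
    finally show ?case
      by (simp only: nat_pow_Suc2[OF x])
  qed
  \<comment> \<open>Start at the top term, which contains \<open>x\<close>, and descend to \<open>H 0 = {\<one>}\<close>.\<close>
  have "x [^] (2 ^ j :: nat) \<in> H (k - j)" if "j \<le> k" for j
    using that
  proof (induction j)
    case 0
    then show ?case
      using H(2) x by simp
  next
    case (Suc j)
    then have "x [^] (2 ^ j :: nat) \<in> H (Suc (k - Suc j))"
      by (simp add: Suc_diff_Suc)
    then have "x [^] (2 ^ j :: nat) \<otimes> x [^] (2 ^ j :: nat) \<in> H (k - Suc j)"
      using Suc.prems inv_pow by (intro square) auto
    then show ?case
      using x by (simp add: nat_pow_mult mult_2)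
  qed
  from this[of k] show ?thesis
    using H(1) by auto
qed

text \<open>
  Two involutions invert their product, whose order is thus a power of two and, not being divisible
  by four, at most \<open>2\<close>. So the involutions commute and, if distinct, generate a Klein four-group,
  against Lagrange's theorem.
\<close>

lemma (in group) nilpotent_unique_involution:
  assumes nil: "nilpotent_group G" and ord4: "\<not> 4 dvd order G"
    and a: "a \<in> carrier G" "ord a = 2" and b: "b \<in> carrier G" "ord b = 2"
  shows "a = b"
proof (rule ccontr)
  assume ne: "a \<noteq> b"
  have aa: "a \<noteq> \<one>" "a \<otimes> a = \<one>" and bb: "b \<noteq> \<one>" "b \<otimes> b = \<one>"
    using a b ord_eq_2_iff by auto
  have inv_a: "inv a = a" and inv_b: "inv b = b"
    using a b aa bb by (simp_all add: inv_equality)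
  have "a \<otimes> (a \<otimes> b) \<otimes> inv a = inv (a \<otimes> b)"
    using a b aa inv_a inv_b by (simp add: inv_mult_group m_assoc[symmetric])
  then obtain k where "(a \<otimes> b) [^] (2 ^ k :: nat) = \<one>"
    using inverted_element_of_nilpotent[OF nil a(1)] a b by blast
  then have "ord (a \<otimes> b) dvd 2 ^ k"
    using a b pow_eq_id by simp
  then obtain j where j: "ord (a \<otimes> b) = 2 ^ j"
    by (metis divides_primepow_nat two_is_prime_nat)
  have "ord (a \<otimes> b) dvd order G"
    using a b by (simp add: ord_dvd_group_order)
  have "j \<le> 1"
  proof (rule ccontr)
    assume "\<not> j \<le> 1"
    then have "(2::nat) ^ 2 dvd 2 ^ j"
      by (intro le_imp_power_dvd) simp
    then show False
      using ord4 j \<open>ord (a \<otimes> b) dvd order G\<close> dvd_trans by fastforce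
  qed
  then have "ord (a \<otimes> b) dvd 2"
    using j by (cases j) auto
  then have "(a \<otimes> b) \<otimes> (a \<otimes> b) = \<one>"
    using a b pow_eq_id[of "a \<otimes> b" 2] by (simp add: numeral_2_eq_2)
  then have comm: "a \<otimes> b = b \<otimes> a"
    using a b inv_a inv_b by (metis inv_equality inv_mult_group m_closed)
  have ab: "a \<otimes> b \<noteq> \<one>" "a \<otimes> b \<noteq> a" "a \<otimes> b \<noteq> b"
    using a b aa bb ne inv_a inv_b by (auto simp: l_cancel_one r_cancel_one dest: inv_equality)
  have *: "a \<otimes> (a \<otimes> b) = b" "a \<otimes> b \<otimes> b = a"
    using a b aa bb by (simp_all add: m_assoc) (simp add: m_assoc[symmetric])
  then have **: "b \<otimes> (a \<otimes> b) = a" "a \<otimes> b \<otimes> a = b"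
    using a b comm by (metis m_assoc)+
  let ?V = "{\<one>, a, b, a \<otimes> b}"
  have "subgroup ?V G"
    using a b aa bb inv_a inv_b comm[symmetric] * ** \<open>a \<otimes> b \<otimes> (a \<otimes> b) = \<one>\<close>
    by unfold_locales (auto simp: inv_mult_group)
  then have "card ?V dvd order G"
    using lagrange by (metis dvd_triv_right)
  moreover have "card ?V = 4"
    using aa bb ab ne by auto
  ultimately show False
    using ord4 by simp
qed

section \<open>Elements of prime-power order\<close>

lemma (in group) prime_power_subgroup_element_order:
  assumes p: "Factorial_Ring.prime p" and S: "subgroup S G" "card S = p ^ k"
    and x: "x \<in> S" "x \<noteq> \<one>"
  obtains i where "ord x = p ^ Suc i"
proof -
  interpret S: group "G\<lparr>carrier := S\<rparr>"
    using S(1) is_group by (rule subgroup.subgroup_is_group)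
  have "x [^] (p ^ k) = \<one>"
    using S.pow_order_eq_1[of x] x S(2) by (simp add: order_def nat_pow_consistent[of x _ S])
  moreover have "x \<in> carrier G"
    using S(1) x(1) by (rule subgroup.mem_carrier)
  ultimately have "ord x dvd p ^ k" "ord x \<noteq> 1"
    using x(2) pow_eq_id ord_eq_1 by auto
  then obtain j where "ord x = p ^ j" "j \<noteq> 0"
    using p by (auto simp: divides_primepow_nat)
  then show thesis
    using that by (cases j) auto
qed

text \<open>
  A subgroup of order \<open>p ^ k\<close> exists by Sylow. The bound excludes the subgroups of order one and
  two, which have fewer than two non-trivial elements.
\<close>

lemma (in group) two_elements_of_prime_power_order:
  assumes p: "Factorial_Ring.prime p" and fin: "finite (carrier G)"
    and dvd: "p ^ k dvd order G" and gt: "p ^ k > 2"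
  obtains a b i j where "a \<in> carrier G" "b \<in> carrier G" "a \<noteq> b"
    "ord a = p ^ Suc i" "ord b = p ^ Suc j"
proof -
  obtain m where "order G = p ^ k * m"
    using dvd by blast
  then obtain S where S: "subgroup S G" "card S = p ^ k"
    using sylow_thm[OF p is_group] fin by blast
  have big: "\<not> S \<subseteq> {x, y}" for x y
    using card_mono[of "{x, y}" S] card_insert_le_m1[of 2 "{y}" x] S(2) gt
    by (auto simp: card_insert_if split: if_splits)
  obtain a where a: "a \<in> S" "a \<noteq> \<one>"
    using big[of \<one> \<one>] by blast
  obtain b where b: "b \<in> S" "b \<noteq> \<one>" "b \<noteq> a"
    using big[of \<one> a] by blast
  obtain i where "ord a = p ^ Suc i"
    using prime_power_subgroup_element_order[OF p S a] .
  moreover obtain j where "ord b = p ^ Suc j"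
    using prime_power_subgroup_element_order[OF p S b(1,2)] .
  ultimately show thesis
    using that a b subgroup.mem_carrier[OF S(1)] by metis
qed

lemma (in group) exists_involution:
  assumes fin: "finite (carrier G)" and even: "even (order G)"
  obtains z where "z \<in> carrier G" "ord z = 2"
proof -
  obtain m where "order G = 2 ^ 1 * m"
    using even by auto
  then obtain S where S: "subgroup S G" "card S = 2 ^ 1"
    using sylow_thm[OF two_is_prime_nat is_group] fin by blast
  have "\<not> S \<subseteq> {\<one>}"
    using card_mono[of "{\<one>}" S] S(2) by auto
  then obtain z where z: "z \<in> S" "z \<noteq> \<one>"
    by blast
  interpret S: group "G\<lparr>carrier := S\<rparr>"
    using S(1) is_group by (rule subgroup.subgroup_is_group)
  have carr: "z \<in> carrier G"
    using S(1) z(1) by (rule subgroup.mem_carrier)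
  have "z [^] (2 :: nat) = \<one>"
    using S.pow_order_eq_1[of z] z S(2) by (simp add: order_def nat_pow_consistent[of z _ S])
  then have "z \<otimes> z = \<one>"
    using carr by (simp add: numeral_2_eq_2)
  then have "ord z = 2"
    using carr z(2) by (simp add: ord_eq_2_iff)
  with carr show thesis
    by (rule that)
qed

section \<open>The arithmetic of the group order\<close>

text \<open>
  No odd prime divides \<open>m\<close>, and neither does \<open>4\<close>.
\<close>

lemma eq_1_or_2_if_prime_powers_le_2:
  fixes m :: nat
  assumes pos: "m > 0" and le: "\<And>q k. Factorial_Ring.prime q \<Longrightarrow> q ^ k dvd m \<Longrightarrow> q ^ k \<le> 2"
  shows "m = 1 \<or> m = 2"
proof -
  obtain y where y: "m = 2 ^ multiplicity 2 m * y" "\<not> 2 dvd y"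
    using multiplicity_decompose'[of m 2] pos by auto
  have "y = 1"
  proof (rule ccontr)
    assume "y \<noteq> 1"
    then obtain q where q: "Factorial_Ring.prime q" "q dvd y"
      using prime_factor_nat by blast
    then have "q \<le> 2"
      using le[of q 1] y(1) by (metis dvd_mult power_one_right)
    then have "q = 2"
      using q(1) prime_ge_2_nat le_antisym by blast
    then show False
      using q(2) y(2) by simp
  qed
  moreover have "2 ^ multiplicity 2 m \<le> (2::nat)"
    by (rule le) (simp_all add: multiplicity_dvd)
  then have "multiplicity 2 m = 0 \<or> multiplicity 2 m = 1"
    using power_le_imp_le_exp[of "2::nat" "multiplicity 2 m" 1] by auto
  ultimately show ?thesis
    using y(1) by auto
qed

text \<open>
  Removing the full power of the one prime \<open>p\<close> that contributes more than \<open>2\<close> leaves a factor \<open>1\<close> or \<open>2\<close>.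
  If there is no such prime, \<open>n\<close> itself is \<open>1\<close> or \<open>2\<close>.
\<close>

lemma prime_power_or_double_if_one_large_prime:
  fixes n :: nat
  assumes pos: "n > 0"
    and one_large: "\<And>p q i j. Factorial_Ring.prime p \<Longrightarrow> Factorial_Ring.prime q \<Longrightarrow>
      p ^ i dvd n \<Longrightarrow> q ^ j dvd n \<Longrightarrow> p ^ i > 2 \<Longrightarrow> q ^ j > 2 \<Longrightarrow> p = q"
  shows "\<exists>p k. Factorial_Ring.prime p \<and> (n = p ^ k \<or> n = 2 * p ^ k)"
proof (cases "\<exists>p i. Factorial_Ring.prime p \<and> p ^ i dvd n \<and> p ^ i > 2")
  case True
  then obtain p i where p: "Factorial_Ring.prime p" "p ^ i dvd n" "p ^ i > 2"
    by blast
  obtain m where m: "n = p ^ multiplicity p n * m" "\<not> p dvd m"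
    using multiplicity_decompose'[of n p] pos p(1) by (metis not_prime_unit less_irrefl)
  have "q ^ k \<le> 2" if q: "Factorial_Ring.prime q" "q ^ k dvd m" for q k
  proof (rule ccontr)
    assume gt: "\<not> q ^ k \<le> 2"
    have "q ^ k dvd n"
      using q(2) m(1) by (metis dvd_mult)
    with gt have "p = q"
      using one_large[OF p(1) q(1) p(2)] p(3) by simp
    moreover have "k \<noteq> 0"
      using gt by (cases k) auto
    ultimately show False
      using q(2) m(2) by (metis dvd_power dvd_trans neq0_conv)
  qed
  moreover have "m > 0"
    using m(1) pos by (cases "m = 0") auto
  ultimately have "m = 1 \<or> m = 2"
    by (rule eq_1_or_2_if_prime_powers_le_2[rotated])
  then show ?thesis
    using m(1) p(1) by (metis mult.commute mult.right_neutral)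
next
  case False
  then have "n = 1 \<or> n = 2"
    using pos by (intro eq_1_or_2_if_prime_powers_le_2) (auto simp: not_less)
  then have "n = 2 ^ 0 \<or> n = 2 * 2 ^ 0"
    by simp
  then show ?thesis
    using two_is_prime_nat by blast
qed

section \<open>Four-cycles in the co-prime graph\<close>

lemma (in group) C4_if_two_prime_power_pairs:
  assumes fin: "finite (carrier G)"
    and p: "Factorial_Ring.prime p" and q: "Factorial_Ring.prime q" and ne: "p \<noteq> q"
    and a: "a \<in> carrier G" "ord a = p ^ Suc i" and c: "c \<in> carrier G" "ord c = p ^ Suc j"
    and b: "b \<in> carrier G" "ord b = q ^ Suc k" and d: "d \<in> carrier G" "ord d = q ^ Suc l"
    and ac: "a \<noteq> c" and bd: "b \<noteq> d"
  shows "\<not> induced_free (with_proj (cycle_graph 4)) (with_proj (coprime_graph G))"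
proof -
  have "coprime p q"
    using p q ne by (rule primes_coprime)
  then have cop: "coprime (p ^ Suc r) (q ^ Suc s)" for r s
    by (intro coprime_power_left_iff[THEN iffD2] disjI1 coprime_power_right_iff[THEN iffD2])
  have nocop: "\<not> coprime (t ^ Suc r) (t ^ Suc s)" if "Factorial_Ring.prime t" for t :: nat and r s
    using coprime_common_divisor_nat[of "t ^ Suc r" "t ^ Suc s" t] that by auto
  have "\<not> coprime (ord a) (ord c)" "\<not> coprime (ord b) (ord d)"
    unfolding a c b d using nocop p q by blast+
  moreover have "coprime (ord a) (ord b)" "coprime (ord b) (ord c)"
    "coprime (ord c) (ord d)" "coprime (ord d) (ord a)"
    unfolding a c b d using cop coprime_commute by blast+
  ultimately show ?thesis
    unfolding coprime_graph_C4_free_iff[OF fin]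
    using a(1) b(1) c(1) d(1) ac bd by blast
qed

lemma (in group) order_of_C4_free:
  assumes fin: "finite (carrier G)"
    and free: "induced_free (with_proj (cycle_graph 4)) (with_proj (coprime_graph G))"
  shows "\<exists>p k. Factorial_Ring.prime p \<and> (order G = p ^ k \<or> order G = 2 * p ^ k)"
proof (rule prime_power_or_double_if_one_large_prime)
  show "order G > 0"
    using fin by (simp add: order_gt_0_iff_finite)
next
  fix p q i j
  assume p: "Factorial_Ring.prime p" "p ^ i dvd order G" "p ^ i > 2"
    and q: "Factorial_Ring.prime q" "q ^ j dvd order G" "q ^ j > 2"
  show "p = q"
  proof (rule ccontr)
    assume ne: "p \<noteq> q"
    obtain a c r s where ac: "a \<in> carrier G" "c \<in> carrier G" "a \<noteq> c"
      "ord a = p ^ Suc r" "ord c = p ^ Suc s"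
      using two_elements_of_prime_power_order[OF p(1) fin p(2,3)] .
    obtain b d t u where bd: "b \<in> carrier G" "d \<in> carrier G" "b \<noteq> d"
      "ord b = q ^ Suc t" "ord d = q ^ Suc u"
      using two_elements_of_prime_power_order[OF q(1) fin q(2,3)] .
    show False
      using C4_if_two_prime_power_pairs[OF fin p(1) q(1) ne ac(1,4) ac(2,5) bd(1,4) bd(2,5)
          ac(3) bd(3)] free by contradiction
  qed
qed

lemma (in group) nilpotent_if_C4_free:
  assumes fin: "finite (carrier G)"
    and free: "induced_free (with_proj (cycle_graph 4)) (with_proj (coprime_graph G))"
  shows "nilpotent_group G"
proof -
  obtain p k where p: "Factorial_Ring.prime p" and ord: "order G = p ^ k \<or> order G = 2 * p ^ k"
    using order_of_C4_free[OF fin free] by blast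
  \<comment> \<open>For \<open>p = 2\<close> or \<open>k = 0\<close> the order \<open>2 * p ^ k\<close> is a power of two.
    Otherwise there is an odd prime to pair with two involutions.\<close>
  consider "order G = p ^ k" | "order G = 2 ^ Suc k" | "order G = 2 ^ 1"
    | "p \<noteq> 2" "k \<noteq> 0" "order G = 2 * p ^ k"
    using ord by (cases "p = 2"; cases "k = 0") auto
  then show ?thesis
  proof cases
    case 1
    then show ?thesis
      by (rule prime_power_order_nilpotent[OF p])
  next
    case 2
    then show ?thesis
      by (rule prime_power_order_nilpotent[OF two_is_prime_nat])
  next
    case 3
    then show ?thesis
      by (rule prime_power_order_nilpotent[OF two_is_prime_nat])
  next
    case 4
    have odd: "p > 2"
      using p \<open>p \<noteq> 2\<close> prime_ge_2_nat[of p] by simp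
    have "p ^ 1 dvd order G" "p ^ 1 > 2"
      using 4 odd by simp_all
    from two_elements_of_prime_power_order[OF p fin this] obtain b d t u
      where bd: "b \<in> carrier G" "d \<in> carrier G" "b \<noteq> d"
        "ord b = p ^ Suc t" "ord d = p ^ Suc u" .
    obtain z where z: "z \<in> carrier G" "ord z = 2"
      using exists_involution[OF fin] 4 by auto
    have "x = z" if x: "x \<in> carrier G" "ord x = 2" for x
    proof (rule ccontr)
      assume "x \<noteq> z"
      then show False
        \<comment> \<open>The zeros express the order \<open>2\<close> of \<open>x\<close> and \<open>z\<close> as \<open>2 ^ Suc 0\<close>.\<close>
        using C4_if_two_prime_power_pairs[OF fin two_is_prime_nat p, of x 0 z 0 b t d u]
          4 x z bd free by simp
    qed
    then show ?thesis
      using nilpotent_if_unique_involution[OF fin p 4(3) z] by blast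
  qed
qed

text \<open>
  Two elements of coprime orders cannot both be non-trivial, but a four-cycle contains such a
  pair.
\<close>

lemma (in group) C4_free_if_prime_power_order:
  assumes fin: "finite (carrier G)" and p: "Factorial_Ring.prime p" and ord: "order G = p ^ k"
  shows "induced_free (with_proj (cycle_graph 4)) (with_proj (coprime_graph G))"
proof -
  have p_dvd: "p dvd ord x" if "x \<in> carrier G" "ord x \<noteq> 1" for x
    using prime_dvd_if_dvd_prime_power[OF that(2) _ p] ord_dvd_group_order[OF that(1)]
    unfolding ord by blast
  have "ord x = 1 \<or> ord y = 1" if "x \<in> carrier G" "y \<in> carrier G" "coprime (ord x) (ord y)" for x y
    using p_dvd that p by (metis coprime_common_divisor_nat not_prime_1)
  then show ?thesis
    unfolding coprime_graph_C4_free_iff[OF fin] by (metis coprime_1_left coprime_1_right)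
qed

text \<open>
  In a four-cycle at least one pair of opposite vertices has orders prime to \<open>p\<close>. These orders divide
  \<open>2\<close>, so the pair consists of two distinct involutions.
\<close>

lemma (in group) C4_free_if_unique_involution:
  assumes fin: "finite (carrier G)" and p: "Factorial_Ring.prime p" and ord: "order G = 2 * p ^ k"
    and unique: "\<And>x y. x \<in> carrier G \<Longrightarrow> y \<in> carrier G \<Longrightarrow> ord x = 2 \<Longrightarrow> ord y = 2 \<Longrightarrow> x = y"
  shows "induced_free (with_proj (cycle_graph 4)) (with_proj (coprime_graph G))"
proof -
  have two: "ord x = 2" if x: "x \<in> carrier G" "ord x \<noteq> 1" "\<not> p dvd ord x" for x
  proof -
    have "coprime (ord x) (p ^ k)"
      using p x(3) by (metis coprime_commute coprime_power_right_iff prime_imp_coprime)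
    then have "ord x dvd 2"
      using ord_dvd_group_order[OF x(1)] unfolding ord by (simp add: coprime_dvd_mult_left_iff)
    then show ?thesis
      using x(2) two_is_prime_nat by (metis prime_nat_iff)
  qed
  show ?thesis
    unfolding coprime_graph_C4_free_iff[OF fin]
  proof (safe)
    fix a b c d
    assume carr: "a \<in> carrier G" "b \<in> carrier G" "c \<in> carrier G" "d \<in> carrier G"
      and nac: "\<not> coprime (ord a) (ord c)" and nbd: "\<not> coprime (ord b) (ord d)"
      and cop: "coprime (ord a) (ord b)" "coprime (ord b) (ord c)"
        "coprime (ord c) (ord d)" "coprime (ord d) (ord a)"
      and ne: "a \<noteq> c" "b \<noteq> d"
    have ne1: "ord a \<noteq> 1" "ord b \<noteq> 1" "ord c \<noteq> 1" "ord d \<noteq> 1"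
      using nac nbd by auto
    have not_both: "\<not> (p dvd m \<and> p dvd n)" if "coprime m n" for m n
      using that p by (metis coprime_common_divisor_nat not_prime_1)
    show False
    proof (cases "p dvd ord a \<or> p dvd ord c")
      case True
      then have "\<not> p dvd ord b" "\<not> p dvd ord d"
        using not_both cop by blast+
      then have "ord b = 2" "ord d = 2"
        using two carr ne1 by blast+
      then show False
        using unique[of b d] carr ne by simp
    next
      case False
      then have "ord a = 2" "ord c = 2"
        using two carr ne1 by blast+
      then show False
        using unique[of a c] carr ne by simp
    qed
  qed
qed

theorem theorem3:
  fixes G :: "('a, 'b) monoid_scheme"
  assumes "group G" and "finite (carrier G)"
  shows "induced_free (with_proj (cycle_graph 4)) (with_proj (coprime_graph G)) \<longleftrightarrow>
    nilpotent_group G \<and>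
    (\<exists>(p::nat) (n::nat). Factorial_Ring.prime p \<and> (order G = p ^ n \<or> order G = 2 * p ^ n))"
    (is "?free \<longleftrightarrow> _")
proof -
  interpret group G by fact
  have ?free if nil: "nilpotent_group G" and p: "Factorial_Ring.prime p"
    and ord: "order G = p ^ n \<or> order G = 2 * p ^ n" for p n :: nat
  proof -
    consider "order G = p ^ n" | "order G = 2 ^ Suc n" | "p \<noteq> 2" "order G = 2 * p ^ n"
      using ord by (cases "p = 2") auto
    then show ?free
    proof cases
      case 1
      then show ?thesis
        using C4_free_if_prime_power_order[OF assms(2) p] by blast
    next
      case 2
      then show ?thesis
        using C4_free_if_prime_power_order[OF assms(2) two_is_prime_nat] by blast
    next
      case 3
      have "odd (p ^ n)"
        using prime_odd_nat[OF p] prime_ge_2_nat[OF p] 3(1) by simp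
      then have "\<not> 4 dvd order G"
        using 3(2) by presburger
      then show ?thesis
        using C4_free_if_unique_involution[OF assms(2) p 3(2)] nilpotent_unique_involution[OF nil]
        by blast
    qed
  qed
  then show ?thesis
    using nilpotent_if_C4_free[OF assms(2)] order_of_C4_free[OF assms(2)] by blast
qed

end
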